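(* Let $p \colon E \to B$ be a fibration. Then $$\mathrm{TC}[p \colon E\to B] \leq \mathrm{TC}^{\Sigma}[p \colon E\to B].$$
   Context: Fibration means Hurewicz fibration, $I=[0,1]$, $G = \mathbb{Z}_2 = \langle g\rangle$. The equivariant sectional category $\mathrm{secat}_G(q)$ of a $G$-map $q \colon X \to Y$ is the least nonnegative integer $k$ such that $Y$ has a cover by $G$-invariant open sets $U_0,\dots,U_k$ with $G$-maps $s_i \colon U_i \to X$ such that $q\circ s_i$ is $G$-homotopic to the inclusion $U_i \hookrightarrow Y$ ($\infty$ if none exists); $\mathrm{secat}$ is the non-equivariant version (trivial group). For a fibration $p \colon E \to B$: $E \times_B E = \{(e_1,e_2)\in E\times E \mid p(e_1)=p(e_2)\}$ with $g\cdot(e_1,e_2)=(e_2,e_1)$; $E^I_B = \{\gamma \in E^I \mid p\circ\gamma \text{ is constant}\}$ (subspace of $E^I$ with compact-open topology) with $(g\cdot\gamma)(t)=\gamma(1-t)$; $\Pi \colon E^I_B \to E \times_B E$, $\Pi(\gamma)=(\gamma(0),\gamma(1))$, is a $G$-fibration. The parametrized topological complexity is $\mathrm{TC}[p \colon E\to B] := \mathrm{secat}(\Pi)$ and the symmetrized parametrized topological complexity is $\mathrm{TC}^{\Sigma}[p \colon E\to B] := \mathrm{secat}_G(\Pi)$. *)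

theory Defs
  imports "HOL-Analysis.Analysis" "HOL-Algebra.Elementary_Groups" "HOL-Algebra.Group_Action"
begin

abbreviation unit_interval :: "real topology"
  where "unit_interval \<equiv> top_of_set {0..1}"


section \<open>The compact-open topology\<close>

definition compact_open_topology :: "'a topology \<Rightarrow> 'b topology \<Rightarrow> ('a \<Rightarrow> 'b) topology"
  where "compact_open_topology X Y = topology_generated_by
     {{f \<in> extensional (topspace X). continuous_map X Y f \<and> f ` K \<subseteq> U} | K U.
        compactin X K \<and> openin Y U}"

lemma topspace_compact_open_topology:
  "topspace (compact_open_topology X Y) = {f \<in> extensional (topspace X). continuous_map X Y f}"
proof -
  have "f \<in> topspace (compact_open_topology X Y)"
    if "f \<in> extensional (topspace X)" "continuous_map X Y f" for f
    unfolding compact_open_topology_def topology_generated_by_topspace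
    by (rule UnionI[of "{f \<in> extensional (topspace X). continuous_map X Y f \<and> f ` {} \<subseteq> {}}"])
       (use that in \<open>blast intro: compactin_empty openin_empty\<close>, use that in simp)
  then show ?thesis
    by (auto simp: compact_open_topology_def)
qed

abbreviation free_path_space :: "'a topology \<Rightarrow> (real \<Rightarrow> 'a) topology"
  where "free_path_space X \<equiv> compact_open_topology unit_interval X"

lemma continuous_map_path_eval:
  "continuous_map (prod_topology unit_interval (free_path_space X)) X (\<lambda>(t, \<gamma>). \<gamma> t)"
  unfolding continuous_map_def
proof (intro conjI allI impI)
  show "(\<lambda>(t, \<gamma>). \<gamma> t) \<in> topspace (prod_topology unit_interval (free_path_space X)) \<rightarrow> topspace X"
    by (auto simp: topspace_compact_open_topology continuous_map_def)
next
  fix U assume U: "openin X U"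
  let ?P = "prod_topology unit_interval (free_path_space X)"
  let ?W = "{x \<in> topspace ?P. (case x of (t, \<gamma>) \<Rightarrow> \<gamma> t) \<in> U}"
  have "\<exists>T. openin ?P T \<and> (t, \<gamma>) \<in> T \<and> T \<subseteq> ?W" if "(t, \<gamma>) \<in> ?W" for t \<gamma>
  proof -
    from that have t: "t \<in> {0..1}" and g: "\<gamma> \<in> extensional {0..1}" "continuous_map unit_interval X \<gamma>"
      and "\<gamma> t \<in> U"
      by (auto simp: topspace_compact_open_topology)
    have op: "openin unit_interval {s \<in> {0..1}. \<gamma> s \<in> U}"
      using openin_continuous_map_preimage[OF g(2) U] by simp
    have "locally_compact_space unit_interval"
      by (simp add: compact_imp_locally_compact_space compact_space_subtopology)
    then have "neighbourhood_base_of (compactin unit_interval) unit_interval"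
      by (subst (asm) locally_compact_space_neighbourhood_base)
         (simp_all add: Hausdorff_space_subtopology)
    then obtain V K where V: "openin unit_interval V" "compactin unit_interval K" "t \<in> V" "V \<subseteq> K"
      "K \<subseteq> {s \<in> {0..1}. \<gamma> s \<in> U}"
      using op t \<open>\<gamma> t \<in> U\<close> unfolding neighbourhood_base_of by (metis (mono_tags, lifting) mem_Collect_eq)
    let ?S = "{f \<in> extensional (topspace unit_interval). continuous_map unit_interval X f \<and> f ` K \<subseteq> U}"
    have "openin (free_path_space X) ?S"
      unfolding compact_open_topology_def
      by (rule topology_generated_by_Basis) (use V U in blast)
    then have 1: "openin ?P (V \<times> ?S)"
      using V by (simp add: openin_prod_Times_iff)
    have 2: "(t, \<gamma>) \<in> V \<times> ?S"
      using V g by auto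
    have "V \<subseteq> {0..1}"
      using openin_subset[OF V(1)] by simp
    moreover have "f s \<in> U" if "s \<in> V" "f ` K \<subseteq> U" for f s
      using that V(4) by blast
    ultimately have 3: "V \<times> ?S \<subseteq> ?W"
      by (simp add: subset_iff topspace_compact_open_topology)
    from 1 2 3 show ?thesis by blast
  qed
  then show "openin ?P ?W"
    by (subst openin_subopen) fast
qed

lemma continuous_map_path_curry:
  assumes H: "continuous_map (prod_topology unit_interval Z) X H"
  shows "continuous_map Z (free_path_space X) (\<lambda>z. \<lambda>t\<in>{0..1}. H (t, z))"
proof -
  let ?c = "\<lambda>z. \<lambda>t\<in>{0..1}. H (t, z)"
  have cont: "continuous_map unit_interval X (?c z)" if "z \<in> topspace Z" for z
  proof -
    have "continuous_map unit_interval (prod_topology unit_interval Z) (\<lambda>t. (t, z))"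
      using that by (intro continuous_intros) auto
    from continuous_map_compose[OF this H] show ?thesis
      by (rule continuous_map_eq) auto
  qed
  show ?thesis
    unfolding compact_open_topology_def
  proof (rule continuous_on_generated_topo)
    fix S assume "S \<in> {{f \<in> extensional (topspace unit_interval). continuous_map unit_interval X f \<and> f ` K \<subseteq> U} | K U.
        compactin unit_interval K \<and> openin X U}"
    then obtain K U where S: "S = {f \<in> extensional {0..1}. continuous_map unit_interval X f \<and> f ` K \<subseteq> U}"
      and K: "compactin unit_interval K" and U: "openin X U"
      by auto
    have K01: "K \<subseteq> {0..1}"
      using compactin_subset_topspace[OF K] by simp
    let ?W = "{x \<in> topspace (prod_topology unit_interval Z). H x \<in> U}"
    have W: "openin (prod_topology unit_interval Z) ?W"
      by (rule openin_continuous_map_preimage[OF H U])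
    have "\<exists>T. openin Z T \<and> z \<in> T \<and> T \<subseteq> ?c -` S \<inter> topspace Z" if "z \<in> ?c -` S \<inter> topspace Z" for z
    proof -
      from that have z: "z \<in> topspace Z" and c: "?c z ` K \<subseteq> U"
        by (simp_all add: S)
      have "H (t, z) \<in> U" if "t \<in> K" for t
      proof -
        have "?c z t \<in> U" using c that by (rule subsetD[OF _ imageI])
        moreover have "t \<in> {0..1}" using that K01 by (rule set_mp[rotated])
        ultimately show ?thesis by simp
      qed
      moreover have "(t, z) \<in> topspace (prod_topology unit_interval Z)" if "t \<in> K" for t
        using subsetD[OF K01 that] z by simp
      ultimately have KW: "K \<times> {z} \<subseteq> ?W"
        by (intro subsetI, elim SigmaE singletonE) (simp only: mem_Collect_eq)
      then obtain A B where "openin unit_interval A" "openin Z B" "K \<subseteq> A" "z \<in> B" "A \<times> B \<subseteq> ?W"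
        using tube_lemma_left[OF W K z KW] by (elim exE conjE)
      have "B \<subseteq> ?c -` S \<inter> topspace Z"
      proof
        fix y assume y: "y \<in> B"
        then have yZ: "y \<in> topspace Z"
          using openin_subset[OF \<open>openin Z B\<close>] by (rule set_mp[rotated])
        have "H (t, y) \<in> U" if "t \<in> K" for t
          using \<open>A \<times> B \<subseteq> ?W\<close> \<open>K \<subseteq> A\<close> y that by (simp add: subset_iff)
        moreover have "?c y t = H (t, y)" if "t \<in> K" for t
          using subsetD[OF K01 that] by simp
        ultimately have "?c y ` K \<subseteq> U"
          by (intro image_subsetI) metis
        then show "y \<in> ?c -` S \<inter> topspace Z"
          using cont[OF yZ] yZ by (simp add: S)
      qed
      then show ?thesis
        using \<open>openin Z B\<close> \<open>z \<in> B\<close> by (intro exI[of _ B]) simp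
    qed
    then show "openin Z (?c -` S \<inter> topspace Z)"
      using openin_subopen[of Z "?c -` S \<inter> topspace Z"] by simp
  next
    have "?c ` topspace Z \<subseteq> topspace (free_path_space X)"
      unfolding topspace_compact_open_topology using cont by (simp add: image_subset_iff)
    then show "?c ` topspace Z \<subseteq> \<Union> {{f \<in> extensional (topspace unit_interval). continuous_map unit_interval X f \<and> f ` K \<subseteq> U} | K U.
        compactin unit_interval K \<and> openin X U}"
      unfolding compact_open_topology_def topology_generated_by_topspace .
  qed
qed


section \<open>Hurewicz fibrations\<close>

definition homotopy_lifting_property ::
    "'z topology \<Rightarrow> 'e topology \<Rightarrow> 'b topology \<Rightarrow> ('e \<Rightarrow> 'b) \<Rightarrow> bool"
  where "homotopy_lifting_property Z E B p \<longleftrightarrow>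
     (\<forall>f H. continuous_map Z E f \<and> continuous_map (prod_topology unit_interval Z) B H \<and>
            (\<forall>z\<in>topspace Z. H (0, z) = p (f z)) \<longrightarrow>
        (\<exists>L. continuous_map (prod_topology unit_interval Z) E L \<and>
             (\<forall>z\<in>topspace Z. L (0, z) = f z) \<and>
             (\<forall>x\<in>topspace (prod_topology unit_interval Z). p (L x) = H x)))"

text \<open>
  A definition cannot quantify over all types of test spaces \<open>Z\<close>. The test spaces are therefore
  taken over one type, large enough to carry the mapping path space of \<open>p\<close>; the lemma
  \<open>hurewicz_fibration_lifting\<close> recovers the lifting property for spaces \<open>Z\<close> over an arbitrary type.
\<close>
definition hurewicz_fibration :: "'e topology \<Rightarrow> 'b topology \<Rightarrow> ('e \<Rightarrow> 'b) \<Rightarrow> bool"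
  where "hurewicz_fibration E B p \<longleftrightarrow>
     continuous_map E B p \<and>
     (\<forall>Z :: ('e \<times> (real \<Rightarrow> 'b)) topology. homotopy_lifting_property Z E B p)"

lemma hurewicz_fibration_lifting:
  fixes E :: "'e topology" and B :: "'b topology" and Z :: "'z topology"
  assumes fib: "hurewicz_fibration E B p"
  shows "homotopy_lifting_property Z E B p"
  unfolding homotopy_lifting_property_def
proof (intro allI impI, elim conjE)
  fix f H
  assume f: "continuous_map Z E f" and H: "continuous_map (prod_topology unit_interval Z) B H"
    and H0: "\<forall>z\<in>topspace Z. H (0, z) = p (f z)"
  define W where "W = subtopology (prod_topology E (free_path_space B)) {(e, \<gamma>). \<gamma> 0 = p e}"
  have e: "continuous_map W E fst"
    unfolding W_def by (intro continuous_map_from_subtopology continuous_map_fst)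
  have s: "continuous_map W (free_path_space B) snd"
    unfolding W_def by (intro continuous_map_from_subtopology continuous_map_snd)
  have "continuous_map (prod_topology unit_interval W) (prod_topology unit_interval (free_path_space B))
     (\<lambda>x. (fst x, (snd \<circ> snd) x))"
    by (intro continuous_map_pairedI continuous_map_fst continuous_map_compose[OF continuous_map_snd s])
  from continuous_map_compose[OF this continuous_map_path_eval]
  have ev: "continuous_map (prod_topology unit_interval W) B (\<lambda>(t, w). snd w t)"
    by (rule continuous_map_eq) auto
  have "homotopy_lifting_property W E B p"
    using fib by (simp add: hurewicz_fibration_def)
  moreover have "\<forall>w\<in>topspace W. (\<lambda>(t, w). snd w t) (0, w) = p (fst w)"
    by (auto simp: W_def)
  ultimately obtain L where L: "continuous_map (prod_topology unit_interval W) E L"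
    and L0: "\<forall>w\<in>topspace W. L (0, w) = fst w"
    and pL: "\<forall>x\<in>topspace (prod_topology unit_interval W). p (L x) = (\<lambda>(t, w). snd w t) x"
    using e ev unfolding homotopy_lifting_property_def by blast
  define c where "c = (\<lambda>z. (f z, \<lambda>t\<in>{0..1}. H (t, z)))"
  have c: "continuous_map Z W c"
    unfolding W_def c_def
    by (intro continuous_map_into_subtopology continuous_map_pairedI f continuous_map_path_curry H)
       (use H0 in auto)
  have "continuous_map (prod_topology unit_interval Z) (prod_topology unit_interval W)
          (\<lambda>x. (fst x, (c \<circ> snd) x))"
    by (intro continuous_map_pairedI continuous_map_fst continuous_map_compose[OF continuous_map_snd c])
  from continuous_map_compose[OF this L]
  have "continuous_map (prod_topology unit_interval Z) E (\<lambda>x. L (fst x, c (snd x)))"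
    by (simp add: o_def)
  moreover have cW: "c z \<in> topspace W" if "z \<in> topspace Z" for z
    using c that by (auto simp: continuous_map_def)
  then have "\<forall>z\<in>topspace Z. L (fst (0, z), c (snd (0, z))) = f z"
    using L0 by (simp add: c_def)
  moreover have "\<forall>x\<in>topspace (prod_topology unit_interval Z). p (L (fst x, c (snd x))) = H x"
  proof
    fix x assume "x \<in> topspace (prod_topology unit_interval Z)"
    then have "fst x \<in> {0..1}" "snd x \<in> topspace Z" by auto
    with pL cW[of "snd x"] show "p (L (fst x, c (snd x))) = H x"
      by (simp add: c_def)
  qed
  ultimately show "\<exists>L. continuous_map (prod_topology unit_interval Z) E L \<and>
             (\<forall>z\<in>topspace Z. L (0, z) = f z) \<and>
             (\<forall>x\<in>topspace (prod_topology unit_interval Z). p (L x) = H x)"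
    by (intro exI[of _ "\<lambda>x. L (fst x, c (snd x))"]) simp
qed


section \<open>Equivariant and ordinary sectional category\<close>

text \<open>
  Actions of a discrete group are families of self-maps \<open>\<phi> a\<close>, of which only the values on the
  underlying space matter; \<open>group_action\<close> wants them extensional, hence the restriction.
\<close>
definition G_space :: "('g, 'm) monoid_scheme \<Rightarrow> ('g \<Rightarrow> 'x \<Rightarrow> 'x) \<Rightarrow> 'x topology \<Rightarrow> bool"
  where "G_space G \<phi> X \<longleftrightarrow>
     group_action G (topspace X) (\<lambda>a. restrict (\<phi> a) (topspace X)) \<and>
     (\<forall>a\<in>carrier G. continuous_map X X (\<phi> a))"

definition equivariant_on ::
    "('g, 'm) monoid_scheme \<Rightarrow> ('g \<Rightarrow> 'x \<Rightarrow> 'x) \<Rightarrow> ('g \<Rightarrow> 'y \<Rightarrow> 'y) \<Rightarrow> 'x set \<Rightarrow> ('x \<Rightarrow> 'y) \<Rightarrow> bool"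
  where "equivariant_on G \<phi> \<psi> S f \<longleftrightarrow> (\<forall>a\<in>carrier G. \<forall>x\<in>S. f (\<phi> a x) = \<psi> a (f x))"

definition G_invariant :: "('g, 'm) monoid_scheme \<Rightarrow> ('g \<Rightarrow> 'x \<Rightarrow> 'x) \<Rightarrow> 'x set \<Rightarrow> bool"
  where "G_invariant G \<phi> U \<longleftrightarrow> (\<forall>a\<in>carrier G. \<forall>x\<in>U. \<phi> a x \<in> U)"

definition has_G_homotopy_section ::
    "('g, 'm) monoid_scheme \<Rightarrow> ('g \<Rightarrow> 'x \<Rightarrow> 'x) \<Rightarrow> 'x topology \<Rightarrow> ('g \<Rightarrow> 'y \<Rightarrow> 'y) \<Rightarrow> 'y topology \<Rightarrow>
      ('x \<Rightarrow> 'y) \<Rightarrow> 'y set \<Rightarrow> bool"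
  where "has_G_homotopy_section G \<phi> X \<psi> Y q U \<longleftrightarrow>
     (\<exists>s. continuous_map (subtopology Y U) X s \<and> equivariant_on G \<psi> \<phi> U s \<and>
          homotopic_with (equivariant_on G \<psi> \<psi> U) (subtopology Y U) Y (q \<circ> s) (\<lambda>y. y))"

text \<open>In \<open>enat\<close>, the infimum of the empty set is \<open>\<infinity>\<close>.\<close>
definition secat_G ::
    "('g, 'm) monoid_scheme \<Rightarrow> ('g \<Rightarrow> 'x \<Rightarrow> 'x) \<Rightarrow> 'x topology \<Rightarrow> ('g \<Rightarrow> 'y \<Rightarrow> 'y) \<Rightarrow> 'y topology \<Rightarrow>
      ('x \<Rightarrow> 'y) \<Rightarrow> enat"
  where "secat_G G \<phi> X \<psi> Y q =
     Inf {enat k | k. \<exists>U :: nat \<Rightarrow> 'y set.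
        (\<forall>i\<le>k. openin Y (U i) \<and> G_invariant G \<psi> (U i) \<and> has_G_homotopy_section G \<phi> X \<psi> Y q (U i)) \<and>
        (\<Union>i\<le>k. U i) = topspace Y}"

definition secat :: "'x topology \<Rightarrow> 'y topology \<Rightarrow> ('x \<Rightarrow> 'y) \<Rightarrow> enat"
  where "secat X Y q = secat_G (singleton_group ()) (\<lambda>_ x. x) X (\<lambda>_ y. y) Y q"

lemma equivariant_on_trivial_group:
  "equivariant_on (singleton_group ()) (\<lambda>_ x. x) (\<lambda>_ y. y) S = (\<lambda>_. True)"
  by (auto simp: equivariant_on_def)

lemma secat_alt:
  "secat X Y q = Inf {enat k | k. \<exists>U :: nat \<Rightarrow> 'y set.
     (\<forall>i\<le>k. openin Y (U i) \<and>
        (\<exists>s. continuous_map (subtopology Y (U i)) X s \<and>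
             homotopic_with (\<lambda>_. True) (subtopology Y (U i)) Y (q \<circ> s) (\<lambda>y. y))) \<and>
     (\<Union>i\<le>k. U i) = topspace Y}"
  by (simp add: secat_def secat_G_def has_G_homotopy_section_def G_invariant_def
      equivariant_on_trivial_group)


section \<open>Parametrized topological complexity\<close>

abbreviation Z2 :: "int monoid"
  where "Z2 \<equiv> integer_mod_group 2"

definition Z2_act :: "('x \<Rightarrow> 'x) \<Rightarrow> int \<Rightarrow> 'x \<Rightarrow> 'x"
  where "Z2_act \<tau> a = (if a = 0 then (\<lambda>x. x) else \<tau>)"

definition fibre_product :: "'e topology \<Rightarrow> ('e \<Rightarrow> 'b) \<Rightarrow> ('e \<times> 'e) topology"
  where "fibre_product E p = subtopology (prod_topology E E) {(e1, e2). p e1 = p e2}"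

definition fibrewise_path_space :: "'e topology \<Rightarrow> ('e \<Rightarrow> 'b) \<Rightarrow> (real \<Rightarrow> 'e) topology"
  where "fibrewise_path_space E p =
     subtopology (free_path_space E) {\<gamma>. (p \<circ> \<gamma>) constant_on {0..1}}"

definition path_reversal :: "(real \<Rightarrow> 'e) \<Rightarrow> real \<Rightarrow> 'e"
  where "path_reversal \<gamma> = (\<lambda>t\<in>{0..1}. \<gamma> (1 - t))"

definition endpoints :: "(real \<Rightarrow> 'e) \<Rightarrow> 'e \<times> 'e"
  where "endpoints \<gamma> = (\<gamma> 0, \<gamma> 1)"

definition parametrized_TC :: "'e topology \<Rightarrow> 'b topology \<Rightarrow> ('e \<Rightarrow> 'b) \<Rightarrow> enat"
  where "parametrized_TC E B p = secat (fibrewise_path_space E p) (fibre_product E p) endpoints"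

definition symmetrized_parametrized_TC :: "'e topology \<Rightarrow> 'b topology \<Rightarrow> ('e \<Rightarrow> 'b) \<Rightarrow> enat"
  where "symmetrized_parametrized_TC E B p =
     secat_G Z2 (Z2_act path_reversal) (fibrewise_path_space E p)
                (Z2_act prod.swap) (fibre_product E p) endpoints"

lemma G_space_Z2I:
  assumes cont: "continuous_map X X \<tau>" and inv: "\<And>x. x \<in> topspace X \<Longrightarrow> \<tau> (\<tau> x) = x"
  shows "G_space Z2 (Z2_act \<tau>) X"
proof -
  let ?S = "topspace X"
  let ?r = "\<lambda>a. restrict (Z2_act \<tau> a) ?S"
  have car: "carrier Z2 = {0, 1}"
    by (auto simp: carrier_integer_mod_group)
  have \<tau>: "\<tau> x \<in> ?S" if "x \<in> ?S" for x
    using cont that by (auto simp: continuous_map_def)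
  have "bij_betw (Z2_act \<tau> a) ?S ?S" for a
    by (rule bij_betwI[where g = "Z2_act \<tau> a"]) (auto simp: Z2_act_def \<tau> inv)
  then have bij: "?r a \<in> Bij ?S" for a
    by (simp add: Bij_def bij_betw_restrict_eq)
  have "?r \<in> hom Z2 (BijGroup ?S)"
  proof (rule homI)
    fix a b assume "a \<in> carrier Z2" "b \<in> carrier Z2"
    then have ab: "a \<in> {0, 1}" "b \<in> {0, 1}" unfolding car by auto
    have "?r ((a + b) mod 2) = compose ?S (?r a) (?r b)"
      using ab by (auto simp: compose_def Z2_act_def fun_eq_iff \<tau> inv)
    then show "?r (a \<otimes>\<^bsub>Z2\<^esub> b) = ?r a \<otimes>\<^bsub>BijGroup ?S\<^esub> ?r b"
      using bij by (simp add: BijGroup_def)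
  qed (use bij in \<open>simp add: BijGroup_def\<close>)
  then have "group_action Z2 ?S ?r"
    by (simp add: group_action_def group_hom_def group_hom_axioms_def group_BijGroup)
  then show ?thesis
    using cont by (auto simp: G_space_def Z2_act_def)
qed

lemma G_space_fibre_product: "G_space Z2 (Z2_act prod.swap) (fibre_product E p)"
proof (rule G_space_Z2I)
  have "continuous_map (prod_topology E E) (prod_topology E E) (\<lambda>x. (snd x, fst x))"
    by (intro continuous_intros)
  then show "continuous_map (fibre_product E p) (fibre_product E p) prod.swap"
    unfolding fibre_product_def
    by (intro continuous_map_into_subtopology continuous_map_from_subtopology)
       (auto simp: prod.swap_def[abs_def])
qed simp

lemma continuous_map_path_reversal:
  "continuous_map (free_path_space E) (free_path_space E) path_reversal"
proof -
  have "continuous_map unit_interval unit_interval (\<lambda>t. 1 - t)"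
    by (auto intro!: continuous_intros)
  then have "continuous_map (prod_topology unit_interval (free_path_space E))
     (prod_topology unit_interval (free_path_space E)) (\<lambda>x. (((\<lambda>t. 1 - t) \<circ> fst) x, snd x))"
    by (intro continuous_map_pairedI continuous_map_snd continuous_map_compose[OF continuous_map_fst])
  from continuous_map_compose[OF this continuous_map_path_eval]
  have "continuous_map (prod_topology unit_interval (free_path_space E)) E (\<lambda>(t, \<gamma>). \<gamma> (1 - t))"
    by (rule continuous_map_eq) auto
  from continuous_map_path_curry[OF this] show ?thesis
    by (simp add: path_reversal_def[abs_def])
qed

lemma G_space_fibrewise_path_space:
  "G_space Z2 (Z2_act path_reversal) (fibrewise_path_space E p)"
proof (rule G_space_Z2I)
  show "continuous_map (fibrewise_path_space E p) (fibrewise_path_space E p) path_reversal"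
    unfolding fibrewise_path_space_def
    by (intro continuous_map_into_subtopology continuous_map_from_subtopology
          continuous_map_path_reversal) (auto simp: path_reversal_def constant_on_def)
next
  fix \<gamma> assume "\<gamma> \<in> topspace (fibrewise_path_space E p)"
  then have "\<gamma> \<in> extensional {0..1}"
    by (simp add: fibrewise_path_space_def topspace_compact_open_topology)
  then show "path_reversal (path_reversal \<gamma>) = \<gamma>"
    by (auto simp: path_reversal_def fun_eq_iff extensional_def)
qed

lemma continuous_map_endpoints:
  "continuous_map (fibrewise_path_space E p) (fibre_product E p) endpoints"
proof -
  have ev: "continuous_map (free_path_space E) E (\<lambda>\<gamma>. \<gamma> t)" if "t \<in> {0..1}" for t
  proof -
    have "continuous_map (free_path_space E) (prod_topology unit_interval (free_path_space E)) (\<lambda>\<gamma>. (t, \<gamma>))"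
      using that by (intro continuous_intros) auto
    from continuous_map_compose[OF this continuous_map_path_eval] show ?thesis
      by (simp add: o_def)
  qed
  have "continuous_map (free_path_space E) (prod_topology E E) endpoints"
    unfolding endpoints_def[abs_def] by (intro continuous_map_pairedI ev) auto
  then show ?thesis
    unfolding fibrewise_path_space_def fibre_product_def
    by (intro continuous_map_into_subtopology continuous_map_from_subtopology)
       (auto simp: endpoints_def constant_on_def)
qed

lemma equivariant_endpoints:
  "equivariant_on Z2 (Z2_act path_reversal) (Z2_act prod.swap)
     (topspace (fibrewise_path_space E p)) endpoints"
  by (auto simp: equivariant_on_def Z2_act_def endpoints_def path_reversal_def)

end

theory Submission
  imports Defs
begin

text \<open>Forgetting the action turns an invariant open cover with equivariant homotopy sections
  into an ordinary one of the same size. This works for any map \<open>q\<close>; the theorem is the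
  case of \<open>endpoints\<close>.\<close>

lemma secat_le_secat_G: "secat X Y q \<le> secat_G G \<phi> X \<psi> Y q"
proof -
  have "\<exists>s. continuous_map (subtopology Y U) X s \<and>
            homotopic_with (\<lambda>_. True) (subtopology Y U) Y (q \<circ> s) (\<lambda>y. y)"
    if "has_G_homotopy_section G \<phi> X \<psi> Y q U" for U
    \<comment> \<open>The same \<open>s\<close> and the same homotopy serve, its stages no longer
      required to be equivariant.\<close>
    using that unfolding has_G_homotopy_section_def by (blast intro: homotopic_with_mono)
  then show ?thesis
    \<comment> \<open>Each \<open>k\<close> admissible equivariantly is admissible with the same
      cover, and a larger set has a smaller infimum.\<close>
    unfolding secat_alt secat_G_def by (intro Inf_superset_mono Collect_mono) metis
qed

theorem proposition4p7:
  fixes E :: "'e topology" and B :: "'b topology" and p :: "'e \<Rightarrow> 'b"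
  assumes "hurewicz_fibration E B p"
  shows "parametrized_TC E B p \<le> symmetrized_parametrized_TC E B p"
  unfolding parametrized_TC_def symmetrized_parametrized_TC_def
  by (rule secat_le_secat_G)

end
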